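(* Let $\mathcal X\subseteq\mathbb R^n$ be open and consider a pHDAE on $\mathcal X$ with coefficients $E,J,R,B,z$ and Hamiltonian $\mathcal H\in C^1(\mathcal X,\mathbb R)$. Let $\overline\nabla\mathcal H$ be a discrete gradient of $\mathcal H$ and let $\overline E,\overline J,\overline R,\overline B$ be consistent approximations of $E,J,R,B$ with $\overline J=-\overline J^\top$ and $\overline R=\overline R^\top\succeq0$ pointwise. Let $h>0$ and suppose that $x^k,x^{k+1}\in\mathcal X$, $f^{k,k+1}\in\mathbb R^n$ and $u^{k,k+1},y^{k,k+1}\in\mathbb R^m$ satisfy (all barred matrix functions evaluated at $(x^k,x^{k+1})$) $$\begin{bmatrix}\overline\nabla\mathcal H(x^k,x^{k+1})\\ 0\\ y^{k,k+1}\end{bmatrix}+\begin{bmatrix}0&-\overline E^\top&0\\ \overline E&\overline J-\overline R&\overline B\\ 0&-\overline B^\top&0\end{bmatrix}\begin{bmatrix}-\frac1h(x^{k+1}-x^k)\\ f^{k,k+1}\\ u^{k,k+1}\end{bmatrix}=0.$$ Then $$\mathcal H(x^{k+1})-\mathcal H(x^k)=-h\,(f^{k,k+1})^\top\overline R(x^k,x^{k+1})f^{k,k+1}+h\,(y^{k,k+1})^\top u^{k,k+1}\le h\,(y^{k,k+1})^\top u^{k,k+1}.$$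
   Context: Gradients are column vectors. A pHDAE on $\mathcal X$ is a system $E(x)\dot x=(J(x)-R(x))z(x)+B(x)u$, $y=B(x)^\top z(x)$ together with a Hamiltonian $\mathcal H\in C^1(\mathcal X,\mathbb R)$, where $E,J,R\in C(\mathcal X,\mathbb R^{n,n})$, $B\in C(\mathcal X,\mathbb R^{n,m})$, $z\in C(\mathcal X,\mathbb R^n)$, $J=-J^\top$ and $R=R^\top\succeq0$ pointwise, and $E(x)^\top z(x)=\nabla\mathcal H(x)$ for all $x\in\mathcal X$. A discrete gradient of $\mathcal H$ is $\overline\nabla\mathcal H\in C(\mathcal X\times\mathcal X,\mathbb R^n)$ with $\overline\nabla\mathcal H(x,x')^\top(x'-x)=\mathcal H(x')-\mathcal H(x)$ for all $x,x'\in\mathcal X$ and $\overline\nabla\mathcal H(x,x)=\nabla\mathcal H(x)$ for all $x\in\mathcal X$. A continuous $\overline F$ on $\mathcal X\times\mathcal X$ is a consistent approximation of a continuous $F$ on $\mathcal X$ if $\overline F(x,x)=F(x)$ for all $x\in\mathcal X$. *)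

theory Defs
  imports "HOL-Analysis.Analysis"
begin

text \<open>
  The library's \<^term>\<open>GDERIV f x :> d\<close> says that \<open>f\<close> is Frechet differentiable at \<open>x\<close> with
  derivative \<open>h \<mapsto> h \<bullet> d\<close>. The value of \<open>grad\<close> at a point where \<open>f\<close> is not differentiable is
  unspecified, so it is only to be used together with a differentiability assumption.
\<close>

definition grad :: "(real ^ 'n \<Rightarrow> real) \<Rightarrow> real ^ 'n \<Rightarrow> real ^ 'n" where
  "grad f x = (THE d. GDERIV f x :> d)"

lemma grad_eqI:
  assumes "GDERIV f x :> d"
  shows "grad f x = d"
  unfolding grad_def
proof (rule the_equality)
  show "GDERIV f x :> d" by (fact assms)
  fix d' assume "GDERIV f x :> d'"
  then have "(\<lambda>h. h \<bullet> d') = (\<lambda>h. h \<bullet> d)"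
    using assms has_derivative_unique unfolding gderiv_def by blast
  then have "h \<bullet> d' = h \<bullet> d" for h by (rule fun_cong)
  then show "d' = d" using vector_eq_ldot[of d' d] by blast
qed

lemma GDERIV_grad:
  assumes "f differentiable (at x)"
  shows "GDERIV f x :> grad f x"
proof -
  from assms obtain f' where f': "(f has_derivative f') (at x)"
    unfolding differentiable_def by blast
  then have "linear f'" by (rule has_derivative_linear)
  then have "f' h = h \<bullet> adjoint f' 1" for h
    using adjoint_works[of f' h 1] by simp
  then have "f' = (\<lambda>h. h \<bullet> adjoint f' 1)" by (rule ext)
  with f' have "GDERIV f x :> adjoint f' 1"
    unfolding gderiv_def by simp
  then show ?thesis using grad_eqI by fastforce
qed

text \<open>Continuously differentiable on an open set.\<close>

definition C1_on :: "(real ^ 'n) set \<Rightarrow> (real ^ 'n \<Rightarrow> real) \<Rightarrow> bool" where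
  "C1_on X H \<longleftrightarrow> (\<forall>x\<in>X. H differentiable (at x)) \<and> continuous_on X (grad H)"

definition skew_symmetric :: "real ^ 'n ^ 'n \<Rightarrow> bool" where
  "skew_symmetric A \<longleftrightarrow> A = - transpose A"

definition sym_psd :: "real ^ 'n ^ 'n \<Rightarrow> bool" where
  "sym_psd A \<longleftrightarrow> A = transpose A \<and> (\<forall>v. 0 \<le> v \<bullet> (A *v v))"

text \<open>
  The port-Hamiltonian DAE
  \<open>E(x) x' = (J(x) - R(x)) z(x) + B(x) u\<close>, \<open>y = B(x)\<^sup>T z(x)\<close>
  is identified with its coefficients and its Hamiltonian; the conditions below are the ones
  that make this data a pHDAE on \<open>X\<close>.
\<close>

definition pHDAE ::
  "(real ^ 'n) set \<Rightarrow> (real ^ 'n \<Rightarrow> real ^ 'n ^ 'n) \<Rightarrow> (real ^ 'n \<Rightarrow> real ^ 'n ^ 'n) \<Rightarrow>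
   (real ^ 'n \<Rightarrow> real ^ 'n ^ 'n) \<Rightarrow> (real ^ 'n \<Rightarrow> real ^ 'm ^ 'n) \<Rightarrow>
   (real ^ 'n \<Rightarrow> real ^ 'n) \<Rightarrow> (real ^ 'n \<Rightarrow> real) \<Rightarrow> bool" where
  "pHDAE X E J R B z H \<longleftrightarrow>
     C1_on X H \<and>
     continuous_on X E \<and> continuous_on X J \<and> continuous_on X R \<and>
     continuous_on X B \<and> continuous_on X z \<and>
     (\<forall>x\<in>X. skew_symmetric (J x)) \<and>
     (\<forall>x\<in>X. sym_psd (R x)) \<and>
     (\<forall>x\<in>X. transpose (E x) *v z x = grad H x)"

definition consistent_approx ::
  "'a::topological_space set \<Rightarrow> ('a \<Rightarrow> 'b::topological_space) \<Rightarrow> ('a \<times> 'a \<Rightarrow> 'b) \<Rightarrow> bool" where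
  "consistent_approx X F Fb \<longleftrightarrow> continuous_on (X \<times> X) Fb \<and> (\<forall>x\<in>X. Fb (x, x) = F x)"

definition discrete_gradient ::
  "(real ^ 'n) set \<Rightarrow> (real ^ 'n \<Rightarrow> real) \<Rightarrow> ((real ^ 'n) \<times> (real ^ 'n) \<Rightarrow> real ^ 'n) \<Rightarrow> bool" where
  "discrete_gradient X H dH \<longleftrightarrow>
     continuous_on (X \<times> X) dH \<and>
     (\<forall>x\<in>X. \<forall>x'\<in>X. dH (x, x') \<bullet> (x' - x) = H x' - H x) \<and>
     (\<forall>x\<in>X. dH (x, x) = grad H x)"

text \<open>
  Three-by-three block vectors and matrices: the rows (columns) of the blocks are indexed by
  the summands of a sum type. In \<open>block_mat3\<close> the nine blocks are listed row by row.
\<close>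

definition block_vec3 ::
  "real ^ 'a \<Rightarrow> real ^ 'b \<Rightarrow> real ^ 'c \<Rightarrow> real ^ ('a + 'b + 'c)" where
  "block_vec3 v1 v2 v3 =
     (\<chi> i. case i of Inl a \<Rightarrow> v1 $ a | Inr (Inl b) \<Rightarrow> v2 $ b | Inr (Inr c) \<Rightarrow> v3 $ c)"

definition block_mat3 ::
  "real ^ 'd ^ 'a \<Rightarrow> real ^ 'e ^ 'a \<Rightarrow> real ^ 'f ^ 'a \<Rightarrow>
   real ^ 'd ^ 'b \<Rightarrow> real ^ 'e ^ 'b \<Rightarrow> real ^ 'f ^ 'b \<Rightarrow>
   real ^ 'd ^ 'c \<Rightarrow> real ^ 'e ^ 'c \<Rightarrow> real ^ 'f ^ 'c \<Rightarrow>
   real ^ ('d + 'e + 'f) ^ ('a + 'b + 'c)" where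
  "block_mat3 A11 A12 A13 A21 A22 A23 A31 A32 A33 =
     (\<chi> i. case i of
        Inl a \<Rightarrow> block_vec3 (A11 $ a) (A12 $ a) (A13 $ a)
      | Inr (Inl b) \<Rightarrow> block_vec3 (A21 $ b) (A22 $ b) (A23 $ b)
      | Inr (Inr c) \<Rightarrow> block_vec3 (A31 $ c) (A32 $ c) (A33 $ c))"

end

theory Submission
  imports Defs
begin

text \<open>
  The middle block row, paired with \<open>f\<close>, is a discrete power balance: the skew part \<open>J\<close> drops
  out, and the outer rows identify \<open>E\<^sup>T f\<close> with the discrete gradient and \<open>B\<^sup>T f\<close> with the output.
\<close>

text \<open>Block vectors are indexed by a sum type, so each entry of a block product is one sum
  over that type; splitting it by summand gives the blockwise product below.\<close>

lemma sum_UNIV_Plus3: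
  fixes g :: "'a::finite + 'b::finite + 'c::finite \<Rightarrow> 'd::comm_monoid_add"
  shows "sum g UNIV =
    (\<Sum>a\<in>UNIV. g (Inl a)) + ((\<Sum>b\<in>UNIV. g (Inr (Inl b))) + (\<Sum>c\<in>UNIV. g (Inr (Inr c))))"
  by (simp only: UNIV_Plus_UNIV[symmetric] sum.Plus finite o_def)

lemma block_mat3_mult_block_vec3:
  "block_mat3 A11 A12 A13 A21 A22 A23 A31 A32 A33 *v block_vec3 v1 v2 v3 =
   block_vec3 (A11 *v v1 + A12 *v v2 + A13 *v v3)
     (A21 *v v1 + A22 *v v2 + A23 *v v3)
     (A31 *v v1 + A32 *v v2 + A33 *v v3)"
  by (simp add: vec_eq_iff matrix_vector_mult_def block_mat3_def block_vec3_def
      sum_UNIV_Plus3 add.assoc split: sum.split)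

lemma block_vec3_add:
  "block_vec3 v1 v2 v3 + block_vec3 w1 w2 w3 = block_vec3 (v1 + w1) (v2 + w2) (v3 + w3)"
  by (simp add: vec_eq_iff block_vec3_def split: sum.split)

lemma block_vec3_eq_0_iff: "block_vec3 v1 v2 v3 = 0 \<longleftrightarrow> v1 = 0 \<and> v2 = 0 \<and> v3 = 0"
  by (auto simp: vec_eq_iff block_vec3_def split_sum_all)

lemma minus_matrix_vector_mult: "(- A) *v v = - (A *v (v :: real ^ 'n))"
  by (simp add: vec_eq_iff matrix_vector_mult_def sum_negf)

text \<open>Moving \<open>A\<close> across the inner product replaces it by its transpose, here
  \<open>- A\<close>; the number thus equals its own negative.\<close>

lemma skew_symmetric_quadratic_form:
  assumes "skew_symmetric A"
  shows "v \<bullet> (A *v v) = 0"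
proof -
  have "v \<bullet> (A *v v) = (transpose A *v v) \<bullet> v"
    by (simp add: dot_lmul_matrix)
  also have "transpose A = - A"
    using assms unfolding skew_symmetric_def by (metis minus_minus)
  finally show ?thesis
    by (simp add: minus_matrix_vector_mult inner_commute)
qed

theorem theorem4p3:
  fixes X :: "(real ^ 'n) set"
    and E J R :: "real ^ 'n \<Rightarrow> real ^ 'n ^ 'n"
    and B :: "real ^ 'n \<Rightarrow> real ^ 'm ^ 'n"
    and z :: "real ^ 'n \<Rightarrow> real ^ 'n"
    and H :: "real ^ 'n \<Rightarrow> real"
    and dH :: "(real ^ 'n) \<times> (real ^ 'n) \<Rightarrow> real ^ 'n"
    and Eb Jb Rb :: "(real ^ 'n) \<times> (real ^ 'n) \<Rightarrow> real ^ 'n ^ 'n"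
    and Bb :: "(real ^ 'n) \<times> (real ^ 'n) \<Rightarrow> real ^ 'm ^ 'n"
    and h :: real
    and x x' f :: "real ^ 'n"
    and u y :: "real ^ 'm"
  assumes "open X"
    and "pHDAE X E J R B z H"
    and "discrete_gradient X H dH"
    and "consistent_approx X E Eb"
    and "consistent_approx X J Jb"
    and "consistent_approx X R Rb"
    and "consistent_approx X B Bb"
    and "\<forall>p\<in>X \<times> X. skew_symmetric (Jb p)"
    and "\<forall>p\<in>X \<times> X. sym_psd (Rb p)"
    and "h > 0"
    and "x \<in> X" and "x' \<in> X"
    and "block_vec3 (dH (x, x')) 0 y +
         block_mat3
           0            (- transpose (Eb (x, x')))    0
           (Eb (x, x')) (Jb (x, x') - Rb (x, x'))     (Bb (x, x'))
           0            (- transpose (Bb (x, x')))    0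
         *v block_vec3 (- ((1 / h) *\<^sub>R (x' - x))) f u = 0"
  shows "H x' - H x = - h * (f \<bullet> (Rb (x, x') *v f)) + h * (y \<bullet> u) \<and>
         - h * (f \<bullet> (Rb (x, x') *v f)) + h * (y \<bullet> u) \<le> h * (y \<bullet> u)"
proof -
  let ?E = "Eb (x, x')" and ?J = "Jb (x, x')" and ?R = "Rb (x, x')" and ?B = "Bb (x, x')"
  let ?w = "- ((1 / h) *\<^sub>R (x' - x))"
  \<comment> \<open>These are the three block rows of the scheme; the minus signs on the transposed
    blocks turn the outer rows into equations solved for \<open>dH (x, x')\<close> and
    \<open>y\<close>.\<close>
  have grad: "dH (x, x') = transpose ?E *v f"
    and flow: "?E *v ?w + (?J - ?R) *v f + ?B *v u = 0"
    and out: "y = transpose ?B *v f"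
    using assms(13)
    by (simp_all only: block_mat3_mult_block_vec3 block_vec3_add block_vec3_eq_0_iff
        minus_matrix_vector_mult matrix_vector_mult_0) simp_all
  have skew: "f \<bullet> (?J *v f) = 0" and psd: "0 \<le> f \<bullet> (?R *v f)"
    using assms(8,9,11,12) by (auto simp: skew_symmetric_quadratic_form sym_psd_def)
  \<comment> \<open>\<open>?w\<close> is the negated difference quotient, so the secant identity of
    the discrete gradient turns the energy increment into a pairing with \<open>?w\<close>.\<close>
  have "x' - x = - h *\<^sub>R ?w"
    using \<open>h > 0\<close> by simp
  then have "H x' - H x = - h * (dH (x, x') \<bullet> ?w)"
    using assms(3,11,12) unfolding discrete_gradient_def by (metis inner_scaleR_right)
  \<comment> \<open>Shifting the transposed \<open>?E\<close> from \<open>f\<close> onto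
    \<open>?w\<close> produces exactly the term that the middle row controls.\<close>
  also have "dH (x, x') \<bullet> ?w = f \<bullet> (?E *v ?w)"
    unfolding grad transpose_matrix_vector by (rule dot_lmul_matrix)
  also have "?E *v ?w = ?R *v f - ?J *v f - ?B *v u"
    using flow by (simp add: matrix_vector_mult_diff_rdistrib algebra_simps)
  \<comment> \<open>The \<open>?J\<close> term vanishes by skew-symmetry, and the adjoint of
    \<open>?B\<close> carries the input term to the output \<open>y\<close>.\<close>
  also have "f \<bullet> \<dots> = f \<bullet> (?R *v f) - y \<bullet> u"
    unfolding out using skew by (simp add: inner_diff_right dot_lmul_matrix)
  \<comment> \<open>Multiplying by \<open>- h\<close> gives the balance; since \<open>h > 0\<close>,
    the dissipation term has the sign needed for the inequality.\<close>
  finally show ?thesis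
    using psd \<open>h > 0\<close> by (simp add: algebra_simps)
qed

end
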